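(* Let the pair of functions $(K>0,\varkappa)$, defined in a domain $\mathcal D\subset\mathbb R^2$, be a solution of the system $$\sqrt[4]{K^2-\varkappa^2}\;\Delta\ln\sqrt[4]{K^2-\varkappa^2}=2K,\qquad \sqrt[4]{K^2-\varkappa^2}\;\Delta\ln\sqrt{\frac{K+\varkappa}{K-\varkappa}}=2\varkappa,\qquad K^2-\varkappa^2>0,\ K>0.\qquad(\mathrm N)$$ Then there exist two (positive) solutions $\nu_1$ and $\nu_2$ of the equation $$\Delta\ln\nu-2\nu=0,\qquad(\mathrm L)$$ defined in the whole domain $\mathcal D$, such that $$K=\frac12\sqrt{\nu_1\nu_2}\,(\nu_1+\nu_2),\qquad \varkappa=-\frac12\sqrt{\nu_1\nu_2}\,(\nu_1-\nu_2).\qquad(\ast)$$ The functions $\nu_1,\nu_2$ are determined uniquely by $K$ and $\varkappa$ through $$\nu_1=\frac{K-\varkappa}{\sqrt[4]{K^2-\varkappa^2}},\qquad \nu_2=\frac{K+\varkappa}{\sqrt[4]{K^2-\varkappa^2}}.$$ Conversely, if $\nu_1$ and $\nu_2$ are two arbitrary (positive) solutions of $(\mathrm L)$, then the equalities $(\ast)$ give a solution $(K>0,\varkappa)$ of the system $(\mathrm N)$.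
   Context: $\Delta=\partial_u^2+\partial_v^2$ is the ordinary Laplace operator in $\mathbb R^2$; all functions are real-valued and smooth. $(\mathrm N)$ is the system of natural equations of maximal space-like surfaces in $\mathbb R^4_2$ and $(\mathrm L)$ is the natural equation of maximal space-like surfaces in $\mathbb R^3_1$. *)

theory Defs
  imports "HOL-Analysis.Analysis"
begin

type_synonym plane = "real \<times> real"

definition plane_domain :: "plane set \<Rightarrow> bool" where
  "plane_domain D \<longleftrightarrow> open D \<and> connected D \<and> D \<noteq> {}"

(* Functions are total in HOL; a function "defined in D" is one whose values outside D are
   arbitrary. Both the smoothness predicate and the Laplacian below depend only on the germ of the
   function at the point in question, so for open D nothing depends on the values outside D. *)

text \<open>\<open>C_on n D f\<close>: \<open>f\<close> is of class \<open>C\<^sup>n\<close> on the open set \<open>D\<close>, by recursion on Frechet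
  differentiability and the directional derivatives in all directions.\<close>

primrec C_on :: "nat \<Rightarrow> plane set \<Rightarrow> (plane \<Rightarrow> real) \<Rightarrow> bool" where
  "C_on 0 D f \<longleftrightarrow> continuous_on D f"
| "C_on (Suc n) D f \<longleftrightarrow>
     (\<forall>p\<in>D. f differentiable (at p)) \<and>
     (\<forall>w. C_on n D (\<lambda>p. frechet_derivative f (at p) w))"

definition smooth_on :: "plane set \<Rightarrow> (plane \<Rightarrow> real) \<Rightarrow> bool" where
  "smooth_on D f \<longleftrightarrow> (\<forall>n. C_on n D f)"

definition partial_u :: "(plane \<Rightarrow> real) \<Rightarrow> plane \<Rightarrow> real" where
  "partial_u f p = deriv (\<lambda>t. f (t, snd p)) (fst p)"

definition partial_v :: "(plane \<Rightarrow> real) \<Rightarrow> plane \<Rightarrow> real" where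
  "partial_v f p = deriv (\<lambda>t. f (fst p, t)) (snd p)"

definition laplacian :: "(plane \<Rightarrow> real) \<Rightarrow> plane \<Rightarrow> real" where
  "laplacian f p = partial_u (partial_u f) p + partial_v (partial_v f) p"

text \<open>The system of natural equations of maximal space-like surfaces in \<open>\<real>\<^sup>4\<^sub>2\<close>.\<close>

definition solves_N :: "plane set \<Rightarrow> (plane \<Rightarrow> real) \<Rightarrow> (plane \<Rightarrow> real) \<Rightarrow> bool" where
  "solves_N D K \<kappa> \<longleftrightarrow>
     smooth_on D K \<and> smooth_on D \<kappa> \<and>
     (\<forall>p\<in>D. K p > 0 \<and> (K p)\<^sup>2 - (\<kappa> p)\<^sup>2 > 0 \<and>
        root 4 ((K p)\<^sup>2 - (\<kappa> p)\<^sup>2) * laplacian (\<lambda>q. ln (root 4 ((K q)\<^sup>2 - (\<kappa> q)\<^sup>2))) p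
          = 2 * K p \<and>
        root 4 ((K p)\<^sup>2 - (\<kappa> p)\<^sup>2) * laplacian (\<lambda>q. ln (sqrt ((K q + \<kappa> q) / (K q - \<kappa> q)))) p
          = 2 * \<kappa> p)"

text \<open>Positive solutions of the natural equation of maximal space-like surfaces in \<open>\<real>\<^sup>3\<^sub>1\<close>.\<close>

definition solves_L :: "plane set \<Rightarrow> (plane \<Rightarrow> real) \<Rightarrow> bool" where
  "solves_L D \<nu> \<longleftrightarrow>
     smooth_on D \<nu> \<and>
     (\<forall>p\<in>D. \<nu> p > 0 \<and> laplacian (\<lambda>q. ln (\<nu> q)) p - 2 * \<nu> p = 0)"

definition star_relation ::
  "plane set \<Rightarrow> (plane \<Rightarrow> real) \<Rightarrow> (plane \<Rightarrow> real) \<Rightarrow> (plane \<Rightarrow> real) \<Rightarrow> (plane \<Rightarrow> real) \<Rightarrow> bool" where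
  "star_relation D K \<kappa> \<nu>\<^sub>1 \<nu>\<^sub>2 \<longleftrightarrow>
     (\<forall>p\<in>D. K p = 1 / 2 * sqrt (\<nu>\<^sub>1 p * \<nu>\<^sub>2 p) * (\<nu>\<^sub>1 p + \<nu>\<^sub>2 p) \<and>
            \<kappa> p = - 1 / 2 * sqrt (\<nu>\<^sub>1 p * \<nu>\<^sub>2 p) * (\<nu>\<^sub>1 p - \<nu>\<^sub>2 p))"

end

theory Submission
  imports Defs
begin

text \<open>With \<open>X = root 4 (K\<^sup>2 - \<kappa>\<^sup>2)\<close> and \<open>Y = sqrt ((K + \<kappa>) / (K - \<kappa>))\<close>, the relation \<open>(\<ast>)\<close> amounts to
  \<open>\<nu>\<^sub>1 = X / Y\<close> and \<open>\<nu>\<^sub>2 = X Y\<close>. So \<open>ln X\<close> and \<open>ln Y\<close> are half the sum and half the difference of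
  \<open>ln \<nu>\<^sub>2\<close> and \<open>ln \<nu>\<^sub>1\<close>, and by linearity of the Laplacian the system for \<open>(K, \<kappa>)\<close> decouples into the
  two equations for \<open>\<nu>\<^sub>1\<close> and \<open>\<nu>\<^sub>2\<close>.\<close>

section \<open>Functions of class C^n\<close>

text \<open>This rule rewrites quantifiers over points of the plane to coordinates, after which facts stated
  for points no longer match.\<close>

declare split_paired_All [simp del]

text \<open>Since \<open>D\<close> is open, functions agreeing on \<open>D\<close> have the same
  derivatives at each of its points. The induction hypothesis then applies to the directional
  derivatives, so \<open>f\<close> and \<open>g\<close> must stay arbitrary.\<close>

lemma C_on_cong:
  assumes "open D" "\<And>p. p \<in> D \<Longrightarrow> f p = g p"
  shows "C_on n D f \<longleftrightarrow> C_on n D g"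
  using assms(2)
proof (induction n arbitrary: f g)
  case 0
  then show ?case by (auto intro: continuous_on_cong)
next
  case (Suc n)
  have D: "(f has_derivative F) (at p) \<longleftrightarrow> (g has_derivative F) (at p)" if "p \<in> D" for p F
    using has_derivative_transform_within_open[OF _ assms(1) that, of f F UNIV g]
      has_derivative_transform_within_open[OF _ assms(1) that, of g F UNIV f] Suc.prems
    by auto
  have "f differentiable (at p) \<longleftrightarrow> g differentiable (at p)" if "p \<in> D" for p
    unfolding differentiable_def using D[OF that] by simp
  moreover have "frechet_derivative f (at p) = frechet_derivative g (at p)" if "p \<in> D" for p
    unfolding frechet_derivative_def using D[OF that] by simp
  then have "C_on n D (\<lambda>p. frechet_derivative f (at p) w) \<longleftrightarrow>
      C_on n D (\<lambda>p. frechet_derivative g (at p) w)" for w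
    by (intro Suc.IH) simp
  ultimately show ?case by simp
qed

text \<open>By uniqueness of derivatives, an explicit derivative \<open>F\<close> can stand in for
  the chosen \<open>frechet_derivative\<close>. The closure properties below can thus be proved from
  the usual differentiation rules.\<close>

lemma C_on_SucI:
  assumes "open D" "\<And>p. p \<in> D \<Longrightarrow> (f has_derivative F p) (at p)"
    and "\<And>w. C_on n D (\<lambda>p. F p w)"
  shows "C_on (Suc n) D f"
proof -
  have "C_on n D (\<lambda>p. frechet_derivative f (at p) w) \<longleftrightarrow> C_on n D (\<lambda>p. F p w)" for w
    using frechet_derivative_at[OF assms(2)] by (intro C_on_cong[OF assms(1)]) simp
  moreover have "f differentiable (at p)" if "p \<in> D" for p
    using assms(2)[OF that] by (rule differentiableI)
  ultimately show ?thesis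
    using assms(3) by simp
qed

lemma C_on_Suc_has_derivative:
  assumes "C_on (Suc n) D f" "p \<in> D"
  shows "(f has_derivative frechet_derivative f (at p)) (at p)"
  using assms by (simp add: frechet_derivative_works)

lemma C_on_frechet_derivative:
  "C_on (Suc n) D f \<Longrightarrow> C_on n D (\<lambda>p. frechet_derivative f (at p) w)"
  by simp

lemma C_on_const: "open D \<Longrightarrow> C_on n D (\<lambda>p. c)"
proof (induction n arbitrary: c)
  case (Suc n)
  show ?case
    by (rule C_on_SucI[OF \<open>open D\<close>, of _ "\<lambda>p w. 0"]) (use Suc in auto)
qed auto

text \<open>The recursion records only derivatives of top order. Differentiability gives continuity
  at the bottom, and the step lowers the order of every directional derivative.\<close>

lemma C_on_SucD:
  assumes "open D" "C_on (Suc n) D f"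
  shows "C_on n D f"
  using assms(2)
proof (induction n arbitrary: f)
  case 0
  then have "f differentiable (at p)" if "p \<in> D" for p
    using that by simp
  then show ?case
    by (auto intro!: continuous_at_imp_continuous_on differentiable_imp_continuous_within)
next
  case (Suc n)
  show ?case
    by (rule C_on_SucI[OF assms(1) C_on_Suc_has_derivative[OF Suc.prems]])
      (blast intro: Suc.IH C_on_frechet_derivative[OF Suc.prems])+
qed

lemma C_on_add:
  assumes "open D" "C_on n D f" "C_on n D g"
  shows "C_on n D (\<lambda>p. f p + g p)"
  using assms(2,3)
proof (induction n arbitrary: f g)
  case (Suc n)
  note f = Suc.prems(1) and g = Suc.prems(2)
  show ?case
  proof (rule C_on_SucI[OF assms(1)])
    show "((\<lambda>p. f p + g p) has_derivative
        (\<lambda>w. frechet_derivative f (at p) w + frechet_derivative g (at p) w)) (at p)"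
      if "p \<in> D" for p
      by (intro has_derivative_add C_on_Suc_has_derivative[OF f that]
          C_on_Suc_has_derivative[OF g that])
    show "C_on n D (\<lambda>p. frechet_derivative f (at p) w + frechet_derivative g (at p) w)" for w
      by (intro Suc.IH C_on_frechet_derivative f g)
  qed
qed (auto intro: continuous_intros)

lemma C_on_mult:
  assumes "open D" "C_on n D f" "C_on n D g"
  shows "C_on n D (\<lambda>p. f p * g p)"
  using assms(2,3)
proof (induction n arbitrary: f g)
  case (Suc n)
  note f = Suc.prems(1) and g = Suc.prems(2)
  show ?case
  proof (rule C_on_SucI[OF assms(1)])
    show "((\<lambda>p. f p * g p) has_derivative
        (\<lambda>w. f p * frechet_derivative g (at p) w + frechet_derivative f (at p) w * g p)) (at p)"
      if "p \<in> D" for p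
      by (intro has_derivative_mult C_on_Suc_has_derivative[OF f that]
          C_on_Suc_has_derivative[OF g that])
    show "C_on n D
        (\<lambda>p. f p * frechet_derivative g (at p) w + frechet_derivative f (at p) w * g p)" for w
      \<comment> \<open>The product rule leaves one factor undifferentiated in each summand; that
        factor is lowered from order \<open>Suc n\<close> to order \<open>n\<close>.\<close>
      by (intro C_on_add[OF assms(1)] Suc.IH C_on_frechet_derivative C_on_SucD[OF assms(1) f]
          C_on_SucD[OF assms(1) g] f g)
  qed
qed (auto intro: continuous_intros)

text \<open>The chain rule gains one order. Regularity is asked of the composite
  \<open>g' (f p)\<close>, a function on the plane, so smoothness of functions of one variable never
  has to be defined.\<close>

lemma C_on_compose_Suc:
  assumes "open D" "C_on (Suc n) D f" "C_on n D (\<lambda>p. g' (f p))"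
    and "\<And>p. p \<in> D \<Longrightarrow> (g has_real_derivative g' (f p)) (at (f p))"
  shows "C_on (Suc n) D (\<lambda>p. g (f p))"
proof (rule C_on_SucI[OF assms(1)])
  fix p assume "p \<in> D"
  with assms show "((\<lambda>p. g (f p)) has_derivative
      (\<lambda>w. frechet_derivative f (at p) w * g' (f p))) (at p)"
    by (intro has_derivative_compose[OF C_on_Suc_has_derivative, of n D f p g])
      (auto simp: has_field_derivative_def mult.commute[of _ "g' (f p)"])
next
  show "C_on n D (\<lambda>p. frechet_derivative f (at p) w * g' (f p))" for w
    by (intro C_on_mult C_on_frechet_derivative assms(1-3))
qed

text \<open>Real powers form a family closed under differentiation up to constants, so the induction
  varies the exponent. This one family covers the square root, the reciprocal fourth root and the
  derivative of \<open>ln\<close>.\<close>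

lemma C_on_powr:
  fixes a :: real
  assumes "open D" "C_on n D f" "\<And>p. p \<in> D \<Longrightarrow> f p > 0"
  shows "C_on n D (\<lambda>p. f p powr a)"
  using assms(2)
proof (induction n arbitrary: a)
  case 0
  have "f p \<noteq> 0" if "p \<in> D" for p
    using assms(3)[OF that] by simp
  with 0 show ?case
    by (auto intro!: continuous_on_powr)
next
  case (Suc n)
  have "C_on n D (\<lambda>p. a * f p powr (a - 1))"
    by (intro C_on_mult C_on_const Suc.IH C_on_SucD[OF assms(1) Suc.prems] assms(1))
  moreover have "((\<lambda>x. x powr a) has_real_derivative a * f p powr (a - 1)) (at (f p))"
    if "p \<in> D" for p
    using assms(3)[OF that] by (auto intro!: has_real_derivative_powr)
  ultimately show ?case
    by (intro C_on_compose_Suc[OF assms(1) Suc.prems, of "\<lambda>x. a * x powr (a - 1)"]) auto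
qed

section \<open>Closure properties of smooth functions\<close>

lemma smooth_on_transform:
  assumes "open D" "smooth_on D g" "\<And>p. p \<in> D \<Longrightarrow> f p = g p"
  shows "smooth_on D f"
  using assms(2) C_on_cong[OF assms(1,3)] by (simp add: smooth_on_def)

lemma smooth_on_const: "open D \<Longrightarrow> smooth_on D (\<lambda>p. c)"
  by (simp add: smooth_on_def C_on_const)

lemma smooth_on_add:
  "open D \<Longrightarrow> smooth_on D f \<Longrightarrow> smooth_on D g \<Longrightarrow> smooth_on D (\<lambda>p. f p + g p)"
  by (simp add: smooth_on_def C_on_add)

lemma smooth_on_mult:
  "open D \<Longrightarrow> smooth_on D f \<Longrightarrow> smooth_on D g \<Longrightarrow> smooth_on D (\<lambda>p. f p * g p)"
  by (simp add: smooth_on_def C_on_mult)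

lemma smooth_on_diff:
  assumes "open D" "smooth_on D f" "smooth_on D g"
  shows "smooth_on D (\<lambda>p. f p - g p)"
  using smooth_on_add[OF assms(1,2) smooth_on_mult[OF assms(1) smooth_on_const[OF assms(1), of "- 1"]
      assms(3)]]
  by simp

lemma smooth_on_powr:
  fixes a :: real
  shows "open D \<Longrightarrow> smooth_on D f \<Longrightarrow> (\<And>p. p \<in> D \<Longrightarrow> f p > 0) \<Longrightarrow> smooth_on D (\<lambda>p. f p powr a)"
  by (simp add: smooth_on_def C_on_powr)

lemma smooth_on_ln:
  assumes "open D" "smooth_on D f" "\<And>p. p \<in> D \<Longrightarrow> f p > 0"
  shows "smooth_on D (\<lambda>p. ln (f p))"
proof -
  \<comment> \<open>The derivative of \<open>ln\<close> is the power with exponent -1, so the chain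
    rule settles all positive orders without an induction; order 0 follows by lowering.\<close>
  have "C_on (Suc n) D (\<lambda>p. ln (f p))" for n
  proof (rule C_on_compose_Suc[OF assms(1), where g = ln and f = f and g' = "\<lambda>x. x powr (- 1)"])
    show "C_on n D (\<lambda>p. f p powr (- 1))"
      using assms by (intro C_on_powr) (auto simp: smooth_on_def)
    show "(ln has_real_derivative f p powr (- 1)) (at (f p))" if "p \<in> D" for p
      using assms(3)[OF that] by (auto intro!: derivative_eq_intros simp: powr_minus_divide)
  qed (use assms in \<open>auto simp: smooth_on_def simp del: C_on.simps\<close>)
  then show ?thesis
    unfolding smooth_on_def by (blast intro: C_on_SucD[OF assms(1)])
qed

lemma smooth_on_frechet_derivative:
  assumes "smooth_on D f"
  shows "smooth_on D (\<lambda>p. frechet_derivative f (at p) w)"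
  unfolding smooth_on_def
proof
  fix n
  have "C_on (Suc n) D f"
    using assms by (simp add: smooth_on_def del: C_on.simps)
  then show "C_on n D (\<lambda>p. frechet_derivative f (at p) w)"
    by (rule C_on_frechet_derivative)
qed

lemma smooth_on_has_derivative:
  "smooth_on D f \<Longrightarrow> p \<in> D \<Longrightarrow> (f has_derivative frechet_derivative f (at p)) (at p)"
  unfolding smooth_on_def by (rule C_on_Suc_has_derivative[of 0]) blast+

section \<open>Linearity of the Laplacian\<close>

lemma partial_derivs_cong:
  assumes "open D" "p \<in> D" "\<And>q. q \<in> D \<Longrightarrow> f q = g q"
  shows "partial_u f p = partial_u g p" "partial_v f p = partial_v g p"
proof -
  have "((\<lambda>t. (t, snd p)) \<longlongrightarrow> (fst p, snd p)) (nhds (fst p))"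
    "((\<lambda>t. (fst p, t)) \<longlongrightarrow> (fst p, snd p)) (nhds (snd p))"
    by (intro tendsto_Pair tendsto_const filterlim_ident)+
  \<comment> \<open>Both coordinate lines through \<open>p\<close> stay in the open set
    \<open>D\<close> near \<open>p\<close>, and \<open>deriv\<close> sees only that part of
    them.\<close>
  then have "\<forall>\<^sub>F t in nhds (fst p). (t, snd p) \<in> D" "\<forall>\<^sub>F t in nhds (snd p). (fst p, t) \<in> D"
    using assms(1,2) by (auto dest!: topological_tendstoD)
  then show "partial_u f p = partial_u g p" "partial_v f p = partial_v g p"
    unfolding partial_u_def partial_v_def
    by (auto intro!: deriv_cong_ev elim!: eventually_mono simp: assms(3))
qed

lemma laplacian_cong:
  assumes "open D" "p \<in> D" "\<And>q. q \<in> D \<Longrightarrow> f q = g q"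
  shows "laplacian f p = laplacian g p"
  unfolding laplacian_def
  by (intro arg_cong2[of _ _ _ _ "(+)"] partial_derivs_cong[OF assms(1,2)]
      partial_derivs_cong[OF assms(1)] assms(3))

text \<open>A partial derivative differentiates \<open>f\<close> along a coordinate line, so the
  chain rule evaluates \<open>F\<close> on the direction of that line.\<close>

lemma partial_derivs_eq:
  assumes "(f has_derivative F) (at p)"
  shows "partial_u f p = F (1, 0)" "partial_v f p = F (0, 1)"
proof -
  interpret linear F
    using assms by (rule has_derivative_linear)
  have "F (t, 0) = F (1, 0) * t" "F (0, t) = F (0, 1) * t" for t
    using scale[of t "(1, 0)"] scale[of t "(0, 1)"] by simp_all
  \<comment> \<open>Linear maps of the real line are multiplications by a number, the form in which
    \<open>has_field_derivative_def\<close> expects a derivative.\<close>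
  then have F: "(\<lambda>t. F (t, 0)) = (*) (F (1, 0))" "(\<lambda>t. F (0, t)) = (*) (F (0, 1))"
    by blast+
  have f: "(f has_derivative F) (at (fst p, snd p))"
    using assms by simp
  have "((\<lambda>t. (t, snd p)) has_derivative (\<lambda>t. (t, 0))) (at (fst p))"
    "((\<lambda>t. (fst p, t)) has_derivative (\<lambda>t. (0, t))) (at (snd p))"
    by (intro has_derivative_Pair has_derivative_ident has_derivative_const)+
  from has_derivative_compose[OF this(1) f] has_derivative_compose[OF this(2) f]
  show "partial_u f p = F (1, 0)" "partial_v f p = F (0, 1)"
    unfolding partial_u_def partial_v_def F
    by (intro DERIV_imp_deriv; simp only: has_field_derivative_def)+
qed

text \<open>Frechet derivatives of smooth functions are again smooth, which makes linearity of
  second derivatives accessible. The inner partial derivatives are identified on all of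
  \<open>D\<close> before the outer ones are taken at \<open>p\<close>.\<close>

lemma laplacian_eq_frechet:
  assumes "open D" "smooth_on D f" "p \<in> D"
  shows "laplacian f p =
    frechet_derivative (\<lambda>q. frechet_derivative f (at q) (1, 0)) (at p) (1, 0) +
    frechet_derivative (\<lambda>q. frechet_derivative f (at q) (0, 1)) (at p) (0, 1)"
proof -
  note d = partial_derivs_eq[OF smooth_on_has_derivative]
  note d' = d[OF smooth_on_frechet_derivative[OF assms(2)] assms(3)]
  have "partial_u (partial_u f) p = partial_u (\<lambda>q. frechet_derivative f (at q) (1, 0)) p"
    "partial_v (partial_v f) p = partial_v (\<lambda>q. frechet_derivative f (at q) (0, 1)) p"
    using assms by (auto intro!: partial_derivs_cong d)
  then show ?thesis
    by (simp add: laplacian_def d')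
qed

lemma frechet_derivative_lincomb:
  assumes "smooth_on D f" "smooth_on D g" "p \<in> D"
  shows "frechet_derivative (\<lambda>q. a * f q + b * g q) (at p) w =
    a * frechet_derivative f (at p) w + b * frechet_derivative g (at p) w"
proof -
  have "((\<lambda>q. a * f q + b * g q) has_derivative (\<lambda>w.
      a * frechet_derivative f (at p) w + b * frechet_derivative g (at p) w)) (at p)"
    using assms by (intro has_derivative_add has_derivative_mult_right smooth_on_has_derivative)
  from fun_cong[OF frechet_derivative_at[OF this], symmetric] show ?thesis .
qed

lemma laplacian_lincomb:
  assumes "open D" "smooth_on D f" "smooth_on D g" "p \<in> D"
  shows "laplacian (\<lambda>q. a * f q + b * g q) p = a * laplacian f p + b * laplacian g p"
proof -
  have s: "smooth_on D (\<lambda>q. a * f q + b * g q)"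
    using assms by (intro smooth_on_add smooth_on_mult smooth_on_const)
  have "frechet_derivative (\<lambda>q. frechet_derivative (\<lambda>q. a * f q + b * g q) (at q) w) (at p) w =
    a * frechet_derivative (\<lambda>q. frechet_derivative f (at q) w) (at p) w +
    b * frechet_derivative (\<lambda>q. frechet_derivative g (at q) w) (at p) w" for w
  proof -
    have "((\<lambda>q. a * frechet_derivative f (at q) w + b * frechet_derivative g (at q) w)
      has_derivative (\<lambda>v. a * frechet_derivative (\<lambda>q. frechet_derivative f (at q) w) (at p) v +
         b * frechet_derivative (\<lambda>q. frechet_derivative g (at q) w) (at p) v)) (at p)"
      using assms by (intro has_derivative_add has_derivative_mult_right
          smooth_on_has_derivative smooth_on_frechet_derivative)
    \<comment> \<open>The first derivative is known to split only at points of \<open>D\<close>;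
      openness of \<open>D\<close> lets this identity be differentiated once more at
      \<open>p\<close>.\<close>
    then have "((\<lambda>q. frechet_derivative (\<lambda>q. a * f q + b * g q) (at q) w)
      has_derivative (\<lambda>v. a * frechet_derivative (\<lambda>q. frechet_derivative f (at q) w) (at p) v +
         b * frechet_derivative (\<lambda>q. frechet_derivative g (at q) w) (at p) v)) (at p)"
      by (rule has_derivative_transform_within_open[OF _ assms(1,4)])
        (simp add: frechet_derivative_lincomb[OF assms(2,3)])
    from fun_cong[OF frechet_derivative_at[OF this], symmetric] show ?thesis .
  qed
  then show ?thesis
    using assms s by (simp add: laplacian_eq_frechet algebra_simps)
qed

section \<open>The correspondence\<close>

lemma root4_eq_sqrt_sqrt: "root 4 x = sqrt (sqrt x)"
  using real_root_mult_exp[of 2 2 x] by (simp add: sqrt_def)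

text \<open>With \<open>s = sqrt (n1 * n2)\<close>, adding and subtracting the two formulas gives
  \<open>k - \<kappa> = s * n1\<close> and \<open>k + \<kappa> = s * n2\<close>. Their product is
  the fourth power of \<open>s\<close>, so the fourth root is \<open>s\<close> and both formulas can
  be solved for \<open>n1\<close> and \<open>n2\<close>. This inversion also yields
  uniqueness.\<close>

lemma pair_from_nu:
  fixes k \<kappa> n1 n2 :: real
  assumes "n1 > 0" "n2 > 0"
    and "k = 1 / 2 * sqrt (n1 * n2) * (n1 + n2)" "\<kappa> = - 1 / 2 * sqrt (n1 * n2) * (n1 - n2)"
  shows "k > 0" "k\<^sup>2 - \<kappa>\<^sup>2 > 0"
    and "root 4 (k\<^sup>2 - \<kappa>\<^sup>2) = sqrt (n1 * n2)"
    and "n1 = (k - \<kappa>) / root 4 (k\<^sup>2 - \<kappa>\<^sup>2)" "n2 = (k + \<kappa>) / root 4 (k\<^sup>2 - \<kappa>\<^sup>2)"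
    and "(k + \<kappa>) / (k - \<kappa>) = n2 / n1"
proof -
  define s where "s = sqrt (n1 * n2)"
  have s: "s > 0" "s\<^sup>2 = n1 * n2"
    using assms(1,2) by (auto simp: s_def)
  have km: "k - \<kappa> = s * n1" and kp: "k + \<kappa> = s * n2"
    unfolding assms(3,4) s_def[symmetric] by (auto simp: field_simps)
  have "k\<^sup>2 - \<kappa>\<^sup>2 = (k - \<kappa>) * (k + \<kappa>)"
    by (simp add: power2_eq_square algebra_simps)
  also have "\<dots> = (s\<^sup>2)\<^sup>2"
    unfolding km kp using s(2) by (simp add: power2_eq_square)
  finally have *: "k\<^sup>2 - \<kappa>\<^sup>2 = (s\<^sup>2)\<^sup>2" .
  then show "k\<^sup>2 - \<kappa>\<^sup>2 > 0" and r: "root 4 (k\<^sup>2 - \<kappa>\<^sup>2) = sqrt (n1 * n2)"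
    unfolding * root4_eq_sqrt_sqrt s_def[symmetric] real_sqrt_abs using s(1) by simp_all
  show "k > 0"
    unfolding assms(3) using assms(1,2) by simp
  show "n1 = (k - \<kappa>) / root 4 (k\<^sup>2 - \<kappa>\<^sup>2)" "n2 = (k + \<kappa>) / root 4 (k\<^sup>2 - \<kappa>\<^sup>2)"
    "(k + \<kappa>) / (k - \<kappa>) = n2 / n1"
    unfolding r km kp s_def[symmetric] using s(1) by auto
qed

text \<open>The two quotients have product \<open>r\<^sup>2\<close>, because the fourth power of
  \<open>r\<close> is \<open>k\<^sup>2 - \<kappa>\<^sup>2\<close>. The square root of the product is
  therefore \<open>r\<close>, which cancels the denominators.\<close>

lemma nu_from_pair:
  fixes k \<kappa> :: real
  assumes "k > 0" "k\<^sup>2 - \<kappa>\<^sup>2 > 0"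
  defines "r \<equiv> root 4 (k\<^sup>2 - \<kappa>\<^sup>2)"
  shows "(k - \<kappa>) / r > 0" "(k + \<kappa>) / r > 0"
    and "k = 1 / 2 * sqrt ((k - \<kappa>) / r * ((k + \<kappa>) / r)) * ((k - \<kappa>) / r + (k + \<kappa>) / r)"
    and "\<kappa> = - 1 / 2 * sqrt ((k - \<kappa>) / r * ((k + \<kappa>) / r)) * ((k - \<kappa>) / r - (k + \<kappa>) / r)"
proof -
  \<comment> \<open>This is where the sign of \<open>k\<close> enters: it makes both factors of
    \<open>k\<^sup>2 - \<kappa>\<^sup>2\<close> positive rather than both negative.\<close>
  have "\<bar>\<kappa>\<bar> < k"
    using assms(1,2) by (simp add: abs_square_less_1 power2_less_imp_less)
  then have pos: "k - \<kappa> > 0" "k + \<kappa> > 0"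
    by auto
  have r: "r > 0" "r\<^sup>2 = sqrt (k\<^sup>2 - \<kappa>\<^sup>2)"
    using assms(2) by (auto simp: r_def root4_eq_sqrt_sqrt)
  then show "(k - \<kappa>) / r > 0" "(k + \<kappa>) / r > 0"
    using pos by auto
  have "(r\<^sup>2)\<^sup>2 = k\<^sup>2 - \<kappa>\<^sup>2"
    unfolding r(2) using assms(2) by simp
  then have "(k - \<kappa>) / r * ((k + \<kappa>) / r) = r\<^sup>2"
    using r(1) by (simp add: field_simps power2_eq_square)
  then have "sqrt ((k - \<kappa>) / r * ((k + \<kappa>) / r)) = r"
    using r(1) by simp
  then show "k = 1 / 2 * sqrt ((k - \<kappa>) / r * ((k + \<kappa>) / r)) * ((k - \<kappa>) / r + (k + \<kappa>) / r)"
    "\<kappa> = - 1 / 2 * sqrt ((k - \<kappa>) / r * ((k + \<kappa>) / r)) * ((k - \<kappa>) / r - (k + \<kappa>) / r)"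
    using r(1) by (simp_all add: field_simps)
qed

section \<open>Transfer of the differential equations\<close>

text \<open>Neither system of equations is assumed here, only smoothness, positivity and
  \<open>star_relation\<close>; hence the identities serve both directions of the
  correspondence.\<close>

lemma laplacian_ln_star:
  assumes D: "open D" "p \<in> D"
    and smooth: "smooth_on D \<nu>\<^sub>1" "smooth_on D \<nu>\<^sub>2"
    and pos: "\<forall>q\<in>D. \<nu>\<^sub>1 q > 0" "\<forall>q\<in>D. \<nu>\<^sub>2 q > 0"
    and star: "star_relation D K \<kappa> \<nu>\<^sub>1 \<nu>\<^sub>2"
  shows "laplacian (\<lambda>q. ln (root 4 ((K q)\<^sup>2 - (\<kappa> q)\<^sup>2))) p =
      (laplacian (\<lambda>q. ln (\<nu>\<^sub>2 q)) p + laplacian (\<lambda>q. ln (\<nu>\<^sub>1 q)) p) / 2"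
    and "laplacian (\<lambda>q. ln (sqrt ((K q + \<kappa> q) / (K q - \<kappa> q)))) p =
      (laplacian (\<lambda>q. ln (\<nu>\<^sub>2 q)) p - laplacian (\<lambda>q. ln (\<nu>\<^sub>1 q)) p) / 2"
proof -
  have ln_smooth: "smooth_on D (\<lambda>q. ln (\<nu>\<^sub>1 q))" "smooth_on D (\<lambda>q. ln (\<nu>\<^sub>2 q))"
    using D(1) smooth pos by (auto intro: smooth_on_ln)
  \<comment> \<open>The difference is written as a sum with coefficient -1/2 so that both identities
    fit \<open>laplacian_lincomb\<close>.\<close>
  have eqs: "ln (root 4 ((K q)\<^sup>2 - (\<kappa> q)\<^sup>2)) = 1 / 2 * ln (\<nu>\<^sub>2 q) + 1 / 2 * ln (\<nu>\<^sub>1 q)"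
    "ln (sqrt ((K q + \<kappa> q) / (K q - \<kappa> q))) = 1 / 2 * ln (\<nu>\<^sub>2 q) + (- 1 / 2) * ln (\<nu>\<^sub>1 q)"
    if "q \<in> D" for q
  proof -
    have n: "root 4 ((K q)\<^sup>2 - (\<kappa> q)\<^sup>2) = sqrt (\<nu>\<^sub>1 q * \<nu>\<^sub>2 q)"
      "(K q + \<kappa> q) / (K q - \<kappa> q) = \<nu>\<^sub>2 q / \<nu>\<^sub>1 q"
      using star that pair_from_nu(3,6)[OF pos[THEN bspec, OF that]] unfolding star_relation_def by blast+
    show "ln (root 4 ((K q)\<^sup>2 - (\<kappa> q)\<^sup>2)) = 1 / 2 * ln (\<nu>\<^sub>2 q) + 1 / 2 * ln (\<nu>\<^sub>1 q)"
      "ln (sqrt ((K q + \<kappa> q) / (K q - \<kappa> q))) = 1 / 2 * ln (\<nu>\<^sub>2 q) + (- 1 / 2) * ln (\<nu>\<^sub>1 q)"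
      unfolding n using pos[THEN bspec, OF that]
      by (simp_all add: ln_sqrt ln_mult ln_div add_divide_distrib diff_divide_distrib)
  qed
  show "laplacian (\<lambda>q. ln (root 4 ((K q)\<^sup>2 - (\<kappa> q)\<^sup>2))) p =
      (laplacian (\<lambda>q. ln (\<nu>\<^sub>2 q)) p + laplacian (\<lambda>q. ln (\<nu>\<^sub>1 q)) p) / 2"
    by (subst laplacian_cong[OF D], erule eqs(1), subst laplacian_lincomb[OF D(1) ln_smooth(2,1) D(2)])
      (simp add: add_divide_distrib)
  show "laplacian (\<lambda>q. ln (sqrt ((K q + \<kappa> q) / (K q - \<kappa> q)))) p =
      (laplacian (\<lambda>q. ln (\<nu>\<^sub>2 q)) p - laplacian (\<lambda>q. ln (\<nu>\<^sub>1 q)) p) / 2"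
    by (subst laplacian_cong[OF D], erule eqs(2), subst laplacian_lincomb[OF D(1) ln_smooth(2,1) D(2)])
      (simp add: diff_divide_distrib)
qed

lemma solves_L_imp_solves_N:
  assumes D: "open D" and L: "solves_L D \<nu>\<^sub>1" "solves_L D \<nu>\<^sub>2"
    and star: "star_relation D K \<kappa> \<nu>\<^sub>1 \<nu>\<^sub>2"
  shows "solves_N D K \<kappa>"
proof -
  have smooth: "smooth_on D \<nu>\<^sub>1" "smooth_on D \<nu>\<^sub>2"
    and pos: "\<forall>q\<in>D. \<nu>\<^sub>1 q > 0" "\<forall>q\<in>D. \<nu>\<^sub>2 q > 0"
    and lap: "\<And>q. q \<in> D \<Longrightarrow> laplacian (\<lambda>q. ln (\<nu>\<^sub>1 q)) q = 2 * \<nu>\<^sub>1 q"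
      "\<And>q. q \<in> D \<Longrightarrow> laplacian (\<lambda>q. ln (\<nu>\<^sub>2 q)) q = 2 * \<nu>\<^sub>2 q"
    using L by (auto simp: solves_L_def)
  have K: "K q = 1 / 2 * sqrt (\<nu>\<^sub>1 q * \<nu>\<^sub>2 q) * (\<nu>\<^sub>1 q + \<nu>\<^sub>2 q)"
    and \<kappa>: "\<kappa> q = - 1 / 2 * sqrt (\<nu>\<^sub>1 q * \<nu>\<^sub>2 q) * (\<nu>\<^sub>1 q - \<nu>\<^sub>2 q)" if "q \<in> D" for q
    using star that unfolding star_relation_def by blast+
  \<comment> \<open>On \<open>D\<close> the product is positive, so its square root is a real power
    and inherits smoothness.\<close>
  have "smooth_on D (\<lambda>q. (\<nu>\<^sub>1 q * \<nu>\<^sub>2 q) powr (1 / 2))"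
    using D smooth pos by (intro smooth_on_powr smooth_on_mult) auto
  then have s: "smooth_on D (\<lambda>q. sqrt (\<nu>\<^sub>1 q * \<nu>\<^sub>2 q))"
    by (rule smooth_on_transform[OF D])
      (use pos in \<open>simp add: powr_half_sqrt less_imp_le\<close>)
  have "smooth_on D (\<lambda>q. 1 / 2 * sqrt (\<nu>\<^sub>1 q * \<nu>\<^sub>2 q) * (\<nu>\<^sub>1 q + \<nu>\<^sub>2 q))"
    by (rule smooth_on_mult smooth_on_add smooth_on_const D s smooth)+
  then have smooth_K: "smooth_on D K"
    by (rule smooth_on_transform[OF D]) (rule K)
  have "smooth_on D (\<lambda>q. - 1 / 2 * sqrt (\<nu>\<^sub>1 q * \<nu>\<^sub>2 q) * (\<nu>\<^sub>1 q - \<nu>\<^sub>2 q))"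
    by (rule smooth_on_mult smooth_on_diff smooth_on_const D s smooth)+
  then have smooth_\<kappa>: "smooth_on D \<kappa>"
    by (rule smooth_on_transform[OF D]) (rule \<kappa>)
  \<comment> \<open>Here \<open>a\<close> and \<open>b\<close> are the values of
    \<open>\<nu>\<^sub>1\<close> and \<open>\<nu>\<^sub>2\<close>, and \<open>2 * a\<close>,
    \<open>2 * b\<close> the Laplacians of their logarithms. The left sides come from
    \<open>laplacian_ln_star\<close>, the right sides from \<open>star_relation\<close>.\<close>
  have halves: "s * ((2 * b + 2 * a) / 2) = 2 * (1 / 2 * s * (a + b))"
    "s * ((2 * b - 2 * a) / 2) = 2 * (- 1 / 2 * s * (a - b))" for a b s :: real
    by (simp_all add: field_simps)
  show ?thesis
    unfolding solves_N_def
  proof (intro conjI ballI smooth_K smooth_\<kappa>)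
    fix p assume p: "p \<in> D"
    note n = pair_from_nu[OF pos[THEN bspec, OF p] K[OF p] \<kappa>[OF p]]
    show "K p > 0" "(K p)\<^sup>2 - (\<kappa> p)\<^sup>2 > 0"
      by (rule n(1) n(2))+
    have eqs: "sqrt (\<nu>\<^sub>1 p * \<nu>\<^sub>2 p) * ((2 * \<nu>\<^sub>2 p + 2 * \<nu>\<^sub>1 p) / 2) = 2 * K p"
      "sqrt (\<nu>\<^sub>1 p * \<nu>\<^sub>2 p) * ((2 * \<nu>\<^sub>2 p - 2 * \<nu>\<^sub>1 p) / 2) = 2 * \<kappa> p"
      unfolding K[OF p] \<kappa>[OF p] by (rule halves)+
    show "root 4 ((K p)\<^sup>2 - (\<kappa> p)\<^sup>2) * laplacian (\<lambda>q. ln (root 4 ((K q)\<^sup>2 - (\<kappa> q)\<^sup>2))) p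
        = 2 * K p"
      "root 4 ((K p)\<^sup>2 - (\<kappa> p)\<^sup>2) *
        laplacian (\<lambda>q. ln (sqrt ((K q + \<kappa> q) / (K q - \<kappa> q)))) p = 2 * \<kappa> p"
      unfolding laplacian_ln_star[OF D p smooth pos star] lap[OF p] n(3) by (rule eqs)+
  qed
qed

text \<open>Decouples the system: \<open>a\<close> and \<open>b\<close> stand for the Laplacians of
  \<open>ln \<nu>\<^sub>1\<close> and \<open>ln \<nu>\<^sub>2\<close>. Subtracting and adding the
  two equations isolates \<open>r * a\<close> and \<open>r * b\<close>.\<close>

lemma solve_half_sum_diff:
  fixes a b k \<kappa> r :: real
  assumes "r > 0" "r * ((b + a) / 2) = 2 * k" "r * ((b - a) / 2) = 2 * \<kappa>"
  shows "a - 2 * ((k - \<kappa>) / r) = 0" "b - 2 * ((k + \<kappa>) / r) = 0"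
proof -
  have "r * a = 2 * (k - \<kappa>)" "r * b = 2 * (k + \<kappa>)"
    using assms(2,3) by (simp_all add: algebra_simps)
  then have "a = 2 * (k - \<kappa>) / r" "b = 2 * (k + \<kappa>) / r"
    using assms(1) by (metis nonzero_mult_div_cancel_left less_irrefl)+
  then show "a - 2 * ((k - \<kappa>) / r) = 0" "b - 2 * ((k + \<kappa>) / r) = 0"
    by simp_all
qed

lemma solves_N_imp_solves_L:
  fixes K \<kappa> :: "plane \<Rightarrow> real"
  assumes D: "open D" and N: "solves_N D K \<kappa>"
  defines "\<nu>\<^sub>1 \<equiv> \<lambda>p. (K p - \<kappa> p) / root 4 ((K p)\<^sup>2 - (\<kappa> p)\<^sup>2)"
    and "\<nu>\<^sub>2 \<equiv> \<lambda>p. (K p + \<kappa> p) / root 4 ((K p)\<^sup>2 - (\<kappa> p)\<^sup>2)"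
  shows "solves_L D \<nu>\<^sub>1" "solves_L D \<nu>\<^sub>2" "star_relation D K \<kappa> \<nu>\<^sub>1 \<nu>\<^sub>2"
proof -
  define r where "r p = root 4 ((K p)\<^sup>2 - (\<kappa> p)\<^sup>2)" for p
  have smooth: "smooth_on D K" "smooth_on D \<kappa>"
    and K: "\<And>p. p \<in> D \<Longrightarrow> K p > 0" and d: "\<And>p. p \<in> D \<Longrightarrow> (K p)\<^sup>2 - (\<kappa> p)\<^sup>2 > 0"
    and lap: "\<And>p. p \<in> D \<Longrightarrow> r p * laplacian (\<lambda>q. ln (root 4 ((K q)\<^sup>2 - (\<kappa> q)\<^sup>2))) p = 2 * K p"
      "\<And>p. p \<in> D \<Longrightarrow>
        r p * laplacian (\<lambda>q. ln (sqrt ((K q + \<kappa> q) / (K q - \<kappa> q)))) p = 2 * \<kappa> p"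
    using N unfolding solves_N_def r_def by blast+
  have r: "r p > 0" if "p \<in> D" for p
    using d[OF that] by (simp add: r_def)
  have "\<nu>\<^sub>1 p > 0" "\<nu>\<^sub>2 p > 0" if "p \<in> D" for p
    unfolding \<nu>\<^sub>1_def \<nu>\<^sub>2_def by (rule nu_from_pair(1,2)[OF K[OF that] d[OF that]])+
  then have pos: "\<forall>p\<in>D. \<nu>\<^sub>1 p > 0" "\<forall>p\<in>D. \<nu>\<^sub>2 p > 0"
    by blast+
  \<comment> \<open>This algebraic relation comes first because \<open>laplacian_ln_star\<close>,
    which leads to the differential equations, takes it as a hypothesis.\<close>
  show star: "star_relation D K \<kappa> \<nu>\<^sub>1 \<nu>\<^sub>2"
    unfolding star_relation_def
  proof (intro ballI conjI)
    fix p assume "p \<in> D"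
    note n = nu_from_pair(3,4)[OF K[OF this] d[OF this]]
    show "K p = 1 / 2 * sqrt (\<nu>\<^sub>1 p * \<nu>\<^sub>2 p) * (\<nu>\<^sub>1 p + \<nu>\<^sub>2 p)"
      unfolding \<nu>\<^sub>1_def \<nu>\<^sub>2_def by (rule n(1))
    show "\<kappa> p = - 1 / 2 * sqrt (\<nu>\<^sub>1 p * \<nu>\<^sub>2 p) * (\<nu>\<^sub>1 p - \<nu>\<^sub>2 p)"
      unfolding \<nu>\<^sub>1_def \<nu>\<^sub>2_def by (rule n(2))
  qed
  \<comment> \<open>Division by the fourth root is multiplication by a power with exponent -1/4, so
    smoothness of the quotients reduces to powers and products.\<close>
  have "smooth_on D (\<lambda>p. (K p * K p - \<kappa> p * \<kappa> p) powr (- (1 / 4)))"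
    using d by (intro smooth_on_powr smooth_on_diff smooth_on_mult D smooth)
      (simp add: power2_eq_square)
  moreover have "inverse (r p) = (K p * K p - \<kappa> p * \<kappa> p) powr (- (1 / 4))" if "p \<in> D" for p
    using root_powr_inverse[OF _ less_imp_le[OF d[OF that]], of 4]
    by (simp add: r_def powr_minus power2_eq_square)
  ultimately have ir: "smooth_on D (\<lambda>p. inverse (r p))"
    by (rule smooth_on_transform[OF D])
  have smooth': "smooth_on D \<nu>\<^sub>1" "smooth_on D \<nu>\<^sub>2"
    unfolding \<nu>\<^sub>1_def \<nu>\<^sub>2_def r_def[symmetric] divide_inverse
    by (rule smooth_on_mult smooth_on_add smooth_on_diff D smooth ir)+
  have eqs: "laplacian (\<lambda>q. ln (\<nu>\<^sub>1 q)) p - 2 * \<nu>\<^sub>1 p = 0"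
    "laplacian (\<lambda>q. ln (\<nu>\<^sub>2 q)) p - 2 * \<nu>\<^sub>2 p = 0" if "p \<in> D" for p
    using solve_half_sum_diff[OF r[OF that]
        lap(1)[OF that, unfolded laplacian_ln_star(1)[OF D that smooth' pos star]]
        lap(2)[OF that, unfolded laplacian_ln_star(2)[OF D that smooth' pos star]]]
    by (simp_all only: \<nu>\<^sub>1_def \<nu>\<^sub>2_def r_def)
  show "solves_L D \<nu>\<^sub>1"
    unfolding solves_L_def by (intro conjI ballI smooth'(1) bspec[OF pos(1)] eqs(1))
  show "solves_L D \<nu>\<^sub>2"
    unfolding solves_L_def by (intro conjI ballI smooth'(2) bspec[OF pos(2)] eqs(2))
qed

theorem theorem12p2:
  fixes D :: "plane set"
  assumes "plane_domain D"
  shows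
    "(\<forall>K \<kappa>. solves_N D K \<kappa> \<longrightarrow>
        (\<exists>\<nu>\<^sub>1 \<nu>\<^sub>2. solves_L D \<nu>\<^sub>1 \<and> solves_L D \<nu>\<^sub>2 \<and> star_relation D K \<kappa> \<nu>\<^sub>1 \<nu>\<^sub>2) \<and>
        (\<forall>\<nu>\<^sub>1 \<nu>\<^sub>2. solves_L D \<nu>\<^sub>1 \<and> solves_L D \<nu>\<^sub>2 \<and> star_relation D K \<kappa> \<nu>\<^sub>1 \<nu>\<^sub>2 \<longrightarrow>
           (\<forall>p\<in>D. \<nu>\<^sub>1 p = (K p - \<kappa> p) / root 4 ((K p)\<^sup>2 - (\<kappa> p)\<^sup>2) \<and>
                  \<nu>\<^sub>2 p = (K p + \<kappa> p) / root 4 ((K p)\<^sup>2 - (\<kappa> p)\<^sup>2))))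
     \<and>
     (\<forall>\<nu>\<^sub>1 \<nu>\<^sub>2 K \<kappa>. solves_L D \<nu>\<^sub>1 \<and> solves_L D \<nu>\<^sub>2 \<and> star_relation D K \<kappa> \<nu>\<^sub>1 \<nu>\<^sub>2 \<longrightarrow>
        solves_N D K \<kappa>)"
proof (intro conjI allI impI ballI; (elim conjE)?)
  have D: "open D"
    using assms by (simp add: plane_domain_def)
  show "\<exists>\<nu>\<^sub>1 \<nu>\<^sub>2. solves_L D \<nu>\<^sub>1 \<and> solves_L D \<nu>\<^sub>2 \<and> star_relation D K \<kappa> \<nu>\<^sub>1 \<nu>\<^sub>2"
    if "solves_N D K \<kappa>" for K \<kappa>
    \<comment> \<open>The witnesses stay schematic until the first rule application fixes them as
      the quotients of the explicit formulas.\<close>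
    by (intro exI conjI) (rule solves_N_imp_solves_L[OF D that])+
  show "solves_N D K \<kappa>"
    if "solves_L D \<nu>\<^sub>1" "solves_L D \<nu>\<^sub>2" "star_relation D K \<kappa> \<nu>\<^sub>1 \<nu>\<^sub>2" for \<nu>\<^sub>1 \<nu>\<^sub>2 K \<kappa>
    using solves_L_imp_solves_N[OF D that] .
  show "\<nu>\<^sub>1 p = (K p - \<kappa> p) / root 4 ((K p)\<^sup>2 - (\<kappa> p)\<^sup>2)"
    "\<nu>\<^sub>2 p = (K p + \<kappa> p) / root 4 ((K p)\<^sup>2 - (\<kappa> p)\<^sup>2)"
    if "solves_L D \<nu>\<^sub>1" "solves_L D \<nu>\<^sub>2" "star_relation D K \<kappa> \<nu>\<^sub>1 \<nu>\<^sub>2" "p \<in> D" for \<nu>\<^sub>1 \<nu>\<^sub>2 K \<kappa> p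
  proof -
    \<comment> \<open>Uniqueness is pointwise: positive numbers related to \<open>K p\<close> and
      \<open>\<kappa> p\<close> by \<open>star_relation\<close> are recovered by the inversion in
      \<open>pair_from_nu\<close>.\<close>
    have "\<nu>\<^sub>1 p > 0" "\<nu>\<^sub>2 p > 0"
      using that unfolding solves_L_def by simp_all
    moreover have "K p = 1 / 2 * sqrt (\<nu>\<^sub>1 p * \<nu>\<^sub>2 p) * (\<nu>\<^sub>1 p + \<nu>\<^sub>2 p)"
      "\<kappa> p = - 1 / 2 * sqrt (\<nu>\<^sub>1 p * \<nu>\<^sub>2 p) * (\<nu>\<^sub>1 p - \<nu>\<^sub>2 p)"
      using that(3,4) unfolding star_relation_def by blast+
    ultimately show "\<nu>\<^sub>1 p = (K p - \<kappa> p) / root 4 ((K p)\<^sup>2 - (\<kappa> p)\<^sup>2)"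
      "\<nu>\<^sub>2 p = (K p + \<kappa> p) / root 4 ((K p)\<^sup>2 - (\<kappa> p)\<^sup>2)"
      by (rule pair_from_nu(4,5))+
  qed
qed

end
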